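(* $K(g)\neq0$ for all $g\in\mathscr H^{n-1}\setminus\{0\}$.
   Context: Let $n\ge2$. $\mathbb H$ denotes the quaternions. The quaternionic Heisenberg group $\mathscr H^{n-1}$ is, as a set, $\mathbb R^{4n-1}=\mathbb R^3\times\mathbb R^{4n-4}$, with elements $g=(\bm t,\bm y)$. Cauchy--Szegő kernel: for $\sigma=x_1+x_2\mathbf i+x_3\mathbf j+x_4\mathbf k\in\mathbb H\setminus\{0\}$ put $s(\sigma)=c_{n-1}\dfrac{\partial^{2(n-1)}}{\partial x_1^{2(n-1)}}\dfrac{\overline\sigma}{|\sigma|^4}$, where $c_{n-1}$ is a nonzero real constant depending only on $n$, and $S(q,p)=s\big(q_1+\overline p_1-2\sum_{k=2}^n\overline p_kq_k\big)$ for $q,p\in\mathbb H^n$. Identify $\bm t\in\mathbb R^3$ with $t_1\mathbf i+t_2\mathbf j+t_3\mathbf k$ and $\mathbb R^{4n-4}$ with $\mathbb H^{n-1}$ (consecutive blocks of four real coordinates). For $t>0$, $g=(\bm t,\bm x)$, $g'=(\bm s,\bm y)$, $K((t,g),g')=S\big((t+|\bm x|^2+\bm t,\bm x),(|\bm y|^2+\bm s,\bm y)\big)$. For $g\ne h$, $K(g,h)=\lim_{t\to0^+}K((t,g),h)$, and $K(g)=K(g,0)$ for $g\neq0$; explicitly $K(\bm t,\bm y)=s(|\bm y|^2+\bm t)$. *)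

theory Defs
  imports "HOL-Analysis.Analysis"
begin

section \<open>The quaternions\<close>

datatype quat = Quat (qRe: real) (qI: real) (qJ: real) (qK: real)

lemma quat_eq_iff: "p = q \<longleftrightarrow> qRe p = qRe q \<and> qI p = qI q \<and> qJ p = qJ q \<and> qK p = qK q"
  by (cases p; cases q) simp

instantiation quat :: ring_1
begin

definition "0 = Quat 0 0 0 0"

definition "1 = Quat 1 0 0 0"

definition "p + q = Quat (qRe p + qRe q) (qI p + qI q) (qJ p + qJ q) (qK p + qK q)"

definition "- p = Quat (- qRe p) (- qI p) (- qJ p) (- qK p)"

definition "p - q = Quat (qRe p - qRe q) (qI p - qI q) (qJ p - qJ q) (qK p - qK q)"

definition "p * q = Quat
  (qRe p * qRe q - qI p * qI q - qJ p * qJ q - qK p * qK q)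
  (qRe p * qI q + qI p * qRe q + qJ p * qK q - qK p * qJ q)
  (qRe p * qJ q - qI p * qK q + qJ p * qRe q + qK p * qI q)
  (qRe p * qK q + qI p * qJ q - qJ p * qI q + qK p * qRe q)"

instance
  by standard
    (simp_all add: quat_eq_iff zero_quat_def one_quat_def plus_quat_def uminus_quat_def
      minus_quat_def times_quat_def algebra_simps)

end

instantiation quat :: real_algebra_1
begin

definition "a *\<^sub>R q = Quat (a * qRe q) (a * qI q) (a * qJ q) (a * qK q)"

instance
  by standard
    (simp_all add: quat_eq_iff scaleR_quat_def plus_quat_def times_quat_def algebra_simps)

end

instantiation quat :: real_inner
begin

definition "inner p q = qRe p * qRe q + qI p * qI q + qJ p * qJ q + qK p * qK q"

definition "norm q = sqrt ((qRe q)\<^sup>2 + (qI q)\<^sup>2 + (qJ q)\<^sup>2 + (qK q)\<^sup>2)" for q :: quat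

definition "sgn q = q /\<^sub>R norm q" for q :: quat

definition "dist p q = norm (p - q)" for p q :: quat

definition "uniformity = (INF e\<in>{0<..}. principal {(p :: quat, q). dist p q < e})"

definition "open U \<longleftrightarrow> (\<forall>p\<in>U. eventually (\<lambda>(p', q). p' = p \<longrightarrow> q \<in> U) uniformity)"
  for U :: "quat set"

instance
proof
  fix p q r :: quat and a :: real and U :: "quat set"
  show "dist p q = norm (p - q)" by (rule dist_quat_def)
  show "sgn p = p /\<^sub>R norm p" by (rule sgn_quat_def)
  show "uniformity = (INF e\<in>{0<..}. principal {(p :: quat, q). dist p q < e})"
    by (rule uniformity_quat_def)
  show "open U \<longleftrightarrow> (\<forall>p\<in>U. eventually (\<lambda>(p', q). p' = p \<longrightarrow> q \<in> U) uniformity)"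
    by (rule open_quat_def)
  show "inner p q = inner q p" by (simp add: inner_quat_def mult.commute)
  show "inner (p + q) r = inner p r + inner q r"
    by (simp add: inner_quat_def plus_quat_def algebra_simps)
  show "inner (a *\<^sub>R p) q = a * inner p q"
    by (simp add: inner_quat_def scaleR_quat_def algebra_simps)
  show "0 \<le> inner p p" by (simp add: inner_quat_def)
  show "inner p p = 0 \<longleftrightarrow> p = 0"
    by (simp add: inner_quat_def quat_eq_iff zero_quat_def add_nonneg_eq_0_iff)
  show "norm p = sqrt (inner p p)"
    by (simp add: inner_quat_def norm_quat_def power2_eq_square)
qed

end

instance quat :: real_normed_algebra_1
proof
  fix p q :: quat
  have "(norm (p * q))\<^sup>2 = (norm p * norm q)\<^sup>2"
    by (simp add: norm_quat_def times_quat_def power_mult_distrib)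
      (simp add: power2_eq_square algebra_simps)
  then have "norm (p * q) = norm p * norm q"
    by (simp add: power2_eq_iff_nonneg)
  then show "norm (p * q) \<le> norm p * norm q"
    by simp
  show "norm (1 :: quat) = 1"
    by (simp add: norm_quat_def one_quat_def)
qed

definition qcnj :: "quat \<Rightarrow> quat" where
  "qcnj q = Quat (qRe q) (- qI q) (- qJ q) (- qK q)"


section \<open>The Cauchy--Szego kernel\<close>

definition partial_x1 :: "(quat \<Rightarrow> quat) \<Rightarrow> quat \<Rightarrow> quat" where
  "partial_x1 f \<sigma> =
     vector_derivative (\<lambda>x. f (Quat x (qI \<sigma>) (qJ \<sigma>) (qK \<sigma>))) (at (qRe \<sigma>))"

text \<open>
  The argument \<open>c\<close> stands for the nonzero normalising constant \<open>c\<^sub>n\<^sub>-\<^sub>1\<close>.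
  Only the values of \<open>szego_s\<close> away from \<open>0\<close> are meaningful.
\<close>

definition szego_s :: "real \<Rightarrow> nat \<Rightarrow> quat \<Rightarrow> quat" where
  "szego_s c n \<sigma> = c *\<^sub>R (partial_x1 ^^ (2 * (n - 1))) (\<lambda>\<tau>. qcnj \<tau> /\<^sub>R norm \<tau> ^ 4) \<sigma>"

text \<open>
  The dimension \<open>n\<close> enters through a finite index type \<open>'m\<close> with \<open>n - 1\<close> elements, which plays the
  role of \<open>{2..n}\<close>.  Thus a point \<open>(q\<^sub>1, q\<^sub>2, \<dots>, q\<^sub>n)\<close> of quaternionic \<open>n\<close>-space is a pair of the
  coordinate \<open>q\<^sub>1\<close> and a vector of the remaining \<open>n - 1\<close> coordinates.  The equation
  \<open>CARD('m) = n - 1\<close> is not part of the definitions below and has to be assumed where they are used.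
\<close>

definition szego_S :: "real \<Rightarrow> nat \<Rightarrow> quat \<times> (quat ^ 'm) \<Rightarrow> quat \<times> (quat ^ 'm) \<Rightarrow> quat" where
  "szego_S c n q p =
     szego_s c n (fst q + qcnj (fst p) - 2 * (\<Sum>k\<in>UNIV. qcnj (snd p $ k) * snd q $ k))"


section \<open>The kernel on the quaternionic Heisenberg group\<close>

text \<open>
  Real \<open>(4n - 4)\<close>-space is represented by its division into \<open>n - 1\<close> blocks of four coordinates.
  The norm of \<open>real ^ 4 ^ 'm\<close> is the Euclidean norm of all \<open>4n - 4\<close> coordinates.
\<close>

type_synonym 'm heis = "(real ^ 3) \<times> (real ^ 4 ^ 'm)"

definition quat_of_vec3 :: "real ^ 3 \<Rightarrow> quat" where
  "quat_of_vec3 t = Quat 0 (t $ 1) (t $ 2) (t $ 3)"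

definition quat_of_vec4 :: "real ^ 4 \<Rightarrow> quat" where
  "quat_of_vec4 v = Quat (v $ 1) (v $ 2) (v $ 3) (v $ 4)"

definition siegel_point :: "real \<Rightarrow> ('m::finite) heis \<Rightarrow> quat \<times> (quat ^ 'm)" where
  "siegel_point t g =
     (of_real (t + (norm (snd g))\<^sup>2) + quat_of_vec3 (fst g), \<chi> k. quat_of_vec4 (snd g $ k))"

definition heis_Kt :: "real \<Rightarrow> nat \<Rightarrow> real \<Rightarrow> ('m::finite) heis \<Rightarrow> 'm heis \<Rightarrow> quat" where
  "heis_Kt c n t g h = szego_S c n (siegel_point t g) (siegel_point 0 h)"

definition heis_K2 :: "real \<Rightarrow> nat \<Rightarrow> ('m::finite) heis \<Rightarrow> 'm heis \<Rightarrow> quat" where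
  "heis_K2 c n g h = Lim (at_right 0) (\<lambda>t. heis_Kt c n t g h)"

definition heis_K :: "real \<Rightarrow> nat \<Rightarrow> ('m::finite) heis \<Rightarrow> quat" where
  "heis_K c n g = heis_K2 c n g 0"

end

theory Submission
  imports Defs
begin

text \<open>
  Every quaternion lies in a slice \<open>\<real> + \<real>u \<cong> \<complex>\<close> with \<open>u\<close> an imaginary unit, and there
  \<open>\<sigma> = z = x + \<i>r\<close> turns \<open>qcnj \<sigma> / |\<sigma>|^4\<close> into \<open>1 / (z\<^sup>2 * cnj z)\<close>.  For \<open>r \<noteq> 0\<close> partial fractions in \<open>x\<close>
  give its \<open>k\<close>-th derivative up to a nonzero factor as
  \<open>2\<i>r(k + 1) / z^(k + 2) + 1 / z^(k + 1) - 1 / cnj z^(k + 1)\<close>.  If this vanished, then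
  \<open>z^(k + 2) = cnj z^(k + 1) * ((k + 2)z - (k + 1)cnj z)\<close>, and comparing absolute values gives
  \<open>|x + \<i>r| = |x + \<i>(2k + 3)r|\<close>, which is impossible.  For \<open>r = 0\<close> the function is \<open>1 / x^3\<close>.
\<close>

text \<open>For an imaginary unit \<open>u\<close> this is the embedding of the complex numbers that
  sends \<open>\<i>\<close> to \<open>u\<close>. Its linearity, isometry and compatibility with
  conjugation carry the kernel over to complex analysis.\<close>

definition slice :: "quat \<Rightarrow> complex \<Rightarrow> quat" where
  "slice u z = of_real (Re z) + Im z *\<^sub>R u"

lemma bounded_linear_slice: "bounded_linear (slice u)"
  unfolding slice_def of_real_def
  by (intro bounded_linear_add bounded_linear_scaleR_const bounded_linear_Re bounded_linear_Im)

lemma quat_sel_arith [simp]: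
  "qRe (p + q) = qRe p + qRe q" "qI (p + q) = qI p + qI q"
  "qJ (p + q) = qJ p + qJ q" "qK (p + q) = qK p + qK q"
  "qRe (p - q) = qRe p - qRe q" "qI (p - q) = qI p - qI q"
  "qJ (p - q) = qJ p - qJ q" "qK (p - q) = qK p - qK q"
  "qRe (a *\<^sub>R p) = a * qRe p" "qI (a *\<^sub>R p) = a * qI p"
  "qJ (a *\<^sub>R p) = a * qJ p" "qK (a *\<^sub>R p) = a * qK p"
  "qRe (of_real a) = a" "qI (of_real a) = 0" "qJ (of_real a) = 0" "qK (of_real a) = 0"
  "qRe 0 = 0" "qI 0 = 0" "qJ 0 = 0" "qK 0 = 0"
  by (simp_all add: plus_quat_def minus_quat_def scaleR_quat_def of_real_def one_quat_def zero_quat_def)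

lemma norm_slice:
  assumes "qRe u = 0" "norm u = 1"
  shows "norm (slice u z) = norm z"
proof -
  have u: "(qI u)\<^sup>2 + (qJ u)\<^sup>2 + (qK u)\<^sup>2 = 1"
    using assms by (simp add: norm_quat_def)
  have "(Re z)\<^sup>2 + (Im z * qI u)\<^sup>2 + (Im z * qJ u)\<^sup>2 + (Im z * qK u)\<^sup>2
      = (Re z)\<^sup>2 + (Im z)\<^sup>2 * ((qI u)\<^sup>2 + (qJ u)\<^sup>2 + (qK u)\<^sup>2)"
    by (simp add: power_mult_distrib distrib_left)
  then show ?thesis
    using assms(1) u by (simp add: norm_quat_def slice_def norm_complex_def)
qed

lemma qcnj_slice: "qRe u = 0 \<Longrightarrow> qcnj (slice u z) = slice u (cnj z)"
  by (simp add: quat_eq_iff qcnj_def slice_def)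

text \<open>The unit and \<open>r\<close> depend on the imaginary part alone, so one slice contains
  the whole line along which \<open>partial_x1\<close> differentiates.\<close>

lemma Quat_eq_slice:
  obtains u r where "qRe u = 0" "norm u = 1" "\<And>x. Quat x a b c = slice u (Complex x r)"
proof (cases "Quat 0 a b c = 0")
  case True
  then have "Quat x a b c = slice (Quat 0 1 0 0) (Complex x 0)" for x
    by (simp add: quat_eq_iff slice_def)
  moreover have "norm (Quat 0 1 0 0) = 1" by (simp add: norm_quat_def)
  ultimately show ?thesis using that[of "Quat 0 1 0 0" 0] by simp
next
  case False
  let ?v = "Quat 0 a b c"
  have "Quat x a b c = slice (?v /\<^sub>R norm ?v) (Complex x (norm ?v))" for x
    using False by (simp add: quat_eq_iff slice_def)
  moreover have "norm (?v /\<^sub>R norm ?v) = 1" using False by simp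
  moreover have "qRe (?v /\<^sub>R norm ?v) = 0" by simp
  ultimately show ?thesis by (intro that)
qed

text \<open>The \<open>k\<close>-th derivative of
  \<open>1 / ((w + \<i> * r)^2 * (w - \<i> * r))\<close>, which is holomorphic in \<open>w\<close>
  and for real \<open>w = x\<close> equals \<open>1 / (z^2 * cnj z)\<close> with
  \<open>z = x + \<i> * r\<close>. At \<open>r = 0\<close> the two poles merge, so the partial
  fractions give way to the derivatives of \<open>1 / w^3\<close>.\<close>

definition szego_slice :: "real \<Rightarrow> nat \<Rightarrow> complex \<Rightarrow> complex" where
  "szego_slice r k w =
    (if r = 0 then (- 1) ^ k * fact (k + 2) / (2 * w ^ (k + 3))
     else (- 1) ^ k * fact k / (4 * of_real r ^ 2) *
       (2 * \<i> * of_real r * of_nat (k + 1) / (w + \<i> * of_real r) ^ (k + 2)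
        + 1 / (w + \<i> * of_real r) ^ (k + 1) - 1 / (w - \<i> * of_real r) ^ (k + 1)))"

lemma has_field_derivative_shifted_inverse_power:
  fixes a w :: complex
  assumes "w + a \<noteq> 0"
  shows "((\<lambda>w. C / (w + a) ^ k) has_field_derivative - C * of_nat k / (w + a) ^ Suc k) (at w)"
proof (cases k)
  case (Suc j)
  have "((\<lambda>w. (w + a) ^ Suc j) has_field_derivative of_nat (Suc j) * (w + a) ^ j) (at w)"
    by (rule DERIV_cong[OF DERIV_power_Suc[OF DERIV_add[OF DERIV_ident DERIV_const]]]) simp
  from DERIV_divide[OF DERIV_const[of C] this]
  have "((\<lambda>w. C / (w + a) ^ Suc j) has_field_derivative
       (0 * (w + a) ^ Suc j - C * (of_nat (Suc j) * (w + a) ^ j)) /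
       ((w + a) ^ Suc j * (w + a) ^ Suc j))
      (at w)"
    using assms by simp
  moreover have "(0 * (w + a) ^ Suc j - C * (of_nat (Suc j) * (w + a) ^ j)) /
       ((w + a) ^ Suc j * (w + a) ^ Suc j)
      = - C * of_nat (Suc j) / (w + a) ^ Suc (Suc j)"
    using assms by (simp add: divide_simps)
  ultimately show ?thesis unfolding Suc by (simp only:)
qed simp

lemma has_field_derivative_szego_slice:
  assumes "w + \<i> * of_real r \<noteq> 0" "w - \<i> * of_real r \<noteq> 0"
  shows "(szego_slice r k has_field_derivative szego_slice r (Suc k) w) (at w)"
proof (cases "r = 0")
  case True
  have fn: "szego_slice r k = (\<lambda>w. (- 1) ^ k * fact (k + 2) / 2 / (w + 0) ^ (k + 3))"
    using True by (auto simp: szego_slice_def)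
  have val: "szego_slice r (Suc k) w
      = - ((- 1) ^ k * fact (k + 2) / 2) * of_nat (k + 3) / (w + 0) ^ Suc (k + 3)"
    using True by (simp add: szego_slice_def minus_divide_left algebra_simps)
  show ?thesis
    unfolding fn val using assms True
    by (intro has_field_derivative_shifted_inverse_power) simp
next
  case False
  let ?a = "\<i> * of_real r"
  let ?c = "(- 1) ^ k * fact k / (4 * of_real r ^ 2) :: complex"
  have fn: "szego_slice r k = (\<lambda>w. ?c * (2 * \<i> * of_real r * of_nat (k + 1) / (w + ?a) ^ (k + 2)
        + 1 / (w + ?a) ^ (k + 1) - 1 / (w + - ?a) ^ (k + 1)))"
    using False by (auto simp: szego_slice_def)
  have val: "szego_slice r (Suc k) w = ?c *
      (- (2 * \<i> * of_real r * of_nat (k + 1)) * of_nat (k + 2) / (w + ?a) ^ Suc (k + 2)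
        + - 1 * of_nat (k + 1) / (w + ?a) ^ Suc (k + 1)
        - - 1 * of_nat (k + 1) / (w + - ?a) ^ Suc (k + 1))"
  proof -
    have c: "(- 1) ^ Suc k * fact (Suc k) / (4 * of_real r ^ 2) = ?c * - of_nat (k + 1)"
      using False by (simp add: field_simps)
    have e: "Suc k + 1 = k + 2" "Suc k + 2 = Suc (k + 2)" "Suc (k + 1) = k + 2"
      by simp_all
    \<comment> \<open>Raising \<open>k\<close> multiplies the prefactor by \<open>- (k + 1)\<close>.
      With \<open>m = k + 1\<close> and \<open>l = k + 2\<close>, this identity moves that factor
      into the bracket, where it becomes the exponents brought down by differentiation.\<close>
    have "C * - m * (x * l / P + 1 / Q - 1 / R) = C * (- (x * m) * l / P + - 1 * m / Q - - 1 * m / R)"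
      for C m x l P Q R :: complex
      by (simp add: divide_inverse algebra_simps)
    with False show ?thesis
      unfolding szego_slice_def c by (simp only: e if_False add_uminus_conv_diff)
  qed
  have "w + - ?a \<noteq> 0" using assms by simp
  then show ?thesis
    unfolding fn val by (intro DERIV_cmult DERIV_add DERIV_diff
        has_field_derivative_shifted_inverse_power assms)
qed

text \<open>Since \<open>norm z ^ 4 = (z * cnj z)^2\<close>, the right-hand side is
  \<open>1 / (z^2 * cnj z)\<close>; what remains is its partial fraction decomposition.\<close>

lemma szego_slice_0:
  assumes "Complex x r \<noteq> 0"
  shows "szego_slice r 0 (of_real x) = cnj (Complex x r) / norm (Complex x r) ^ 4"
proof -
  define z where "z = Complex x r"
  have z: "z \<noteq> 0" "cnj z \<noteq> 0" using assms by (auto simp: z_def)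
  have "complex_of_real (norm z) ^ 4 = (complex_of_real (norm z) ^ 2) ^ 2" by simp
  also have "\<dots> = (z * cnj z) ^ 2"
    using complex_norm_square[of z] by simp
  finally have rhs: "cnj z / norm z ^ 4 = 1 / (z ^ 2 * cnj z)"
    using z by (simp add: field_simps power2_eq_square)
  have zw: "of_real x + \<i> * of_real r = z" "of_real x - \<i> * of_real r = cnj z"
    by (simp_all add: z_def complex_eq_iff)
  show ?thesis
  proof (cases "r = 0")
    case True
    then have "z = of_real x" "cnj z = of_real x" by (simp_all add: z_def complex_eq_iff)
    then show ?thesis using rhs True unfolding z_def[symmetric]
      by (simp add: szego_slice_def power2_eq_square power3_eq_cube mult.assoc)
  next
    case False
    \<comment> \<open>Eliminating \<open>r\<close> turns the decomposition into a rational identity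
      in \<open>z\<close> and \<open>cnj z\<close>.\<close>
    have r: "2 * \<i> * of_real r = z - cnj z" "4 * of_real r ^ 2 = - ((z - cnj z) ^ 2)"
      by (simp_all add: z_def complex_eq_iff power2_eq_square)
    have "z - cnj z \<noteq> 0" using False by (simp add: r(1)[symmetric])
    moreover have "szego_slice r 0 (of_real x)
        = 1 / (- ((z - cnj z) ^ 2)) * ((z - cnj z) / z ^ 2 + 1 / z - 1 / cnj z)"
      using False r by (simp add: szego_slice_def zw) (simp add: power2_eq_square)
    moreover have "(z - cnj z) / z ^ 2 + 1 / z - 1 / cnj z = - ((z - cnj z) ^ 2) * (1 / (z ^ 2 * cnj z))"
      using z by (simp add: divide_simps) (simp add: power2_eq_square algebra_simps)
    ultimately show ?thesis using rhs unfolding z_def[symmetric] by simp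
  qed
qed

lemma szego_slice_nonzero:
  assumes "Complex x r \<noteq> 0"
  shows "szego_slice r k (of_real x) \<noteq> 0"
proof (cases "r = 0")
  case True
  then have "x \<noteq> 0" using assms by (auto simp: complex_eq_iff)
  then show ?thesis
    using True fact_nonzero[of "k + 2", where ?'a = complex]
    by (simp add: szego_slice_def del: fact_Suc)
next
  case False
  define z where "z = Complex x r"
  have z: "z \<noteq> 0" "cnj z \<noteq> 0" using assms by (auto simp: z_def)
  have zw: "of_real x + \<i> * of_real r = z" "of_real x - \<i> * of_real r = cnj z"
    by (simp_all add: z_def complex_eq_iff)
  show ?thesis
  proof
    assume "szego_slice r k (of_real x) = 0"
    then have "2 * \<i> * of_real r * of_nat (k + 1) / z ^ (k + 2) + 1 / z ^ (k + 1)
        = 1 / cnj z ^ (k + 1)"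
      using False by (simp add: szego_slice_def zw)
    \<comment> \<open>After this multiplication the left side is affine in \<open>r\<close>, with
      explicit modulus, while the right side has modulus \<open>norm z\<close>.\<close>
    then have "z ^ (k + 2) * (2 * \<i> * of_real r * of_nat (k + 1) / z ^ (k + 2) + 1 / z ^ (k + 1))
        = z ^ (k + 2) * (1 / cnj z ^ (k + 1))"
      by (rule arg_cong)
    moreover have "z ^ (k + 2) * (2 * \<i> * of_real r * of_nat (k + 1) / z ^ (k + 2) + 1 / z ^ (k + 1))
        = 2 * \<i> * of_real r * of_nat (k + 1) + z"
      using z by (simp add: field_simps)
    \<comment> \<open>The factor \<open>2 * k + 3\<close> is \<open>2 * (k + 1)\<close> from the
      double pole plus \<open>1\<close> from \<open>z\<close> itself.\<close>
    moreover have "\<dots> = Complex x (of_nat (2 * k + 3) * r)"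
      by (simp add: z_def complex_eq_iff algebra_simps)
    ultimately have "norm (Complex x (of_nat (2 * k + 3) * r))
        = norm (z ^ (k + 2) * (1 / cnj z ^ (k + 1)))"
      by simp
    also have "\<dots> = norm z"
      using z by (simp add: norm_mult norm_divide norm_power)
    finally have "(of_nat (2 * k + 3) * r)\<^sup>2 = r\<^sup>2"
      by (simp add: norm_complex_def z_def)
    then have "(real (2 * k + 3))\<^sup>2 = 1"
      using False by (simp add: power_mult_distrib)
    then show False
      by (simp add: power2_eq_1_iff)
  qed
qed

text \<open>Each \<open>partial_x1\<close> sees only the line with fixed imaginary part. Openness of
  \<open>S\<close> makes the induction hypothesis hold near \<open>x\<close>, as the next derivative
  requires.\<close>

lemma funpow_partial_x1:
  assumes "open S"
    and F: "\<And>x. x \<in> S \<Longrightarrow> F (Quat x a b c) = h 0 x"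
    and h: "\<And>k x. x \<in> S \<Longrightarrow> (h k has_vector_derivative h (Suc k) x) (at x)"
    and "x \<in> S"
  shows "(partial_x1 ^^ k) F (Quat x a b c) = h k x"
  using \<open>x \<in> S\<close>
proof (induction k arbitrary: x)
  case 0
  then show ?case by (simp add: F)
next
  case (Suc k)
  have "((\<lambda>x. (partial_x1 ^^ k) F (Quat x a b c)) has_vector_derivative h (Suc k) x) (at x)"
    using h[OF Suc.prems] \<open>open S\<close> Suc.prems
    by (rule has_vector_derivative_transform_within_open) (simp add: Suc.IH)
  then show ?case
    by (simp add: partial_x1_def[of "(partial_x1 ^^ k) F"] vector_derivative_at)
qed

text \<open>The complex derivative is restricted to the real axis and then pushed through the
  bounded linear map \<open>slice u\<close>.\<close>

lemma has_vector_derivative_slice_szego: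
  assumes "Complex x r \<noteq> 0"
  shows "((\<lambda>x. slice u (szego_slice r k (of_real x))) has_vector_derivative
    slice u (szego_slice r (Suc k) (of_real x))) (at x)"
proof (rule bounded_linear.has_vector_derivative[OF bounded_linear_slice])
  have "of_real x + \<i> * of_real r \<noteq> 0" "of_real x - \<i> * of_real r \<noteq> 0"
    using assms by (auto simp: complex_eq_iff)
  then show "((\<lambda>x. szego_slice r k (of_real x)) has_vector_derivative
      szego_slice r (Suc k) (of_real x)) (at x)"
    by (intro has_vector_derivative_real_field has_field_derivative_szego_slice)
qed

lemma szego_s_slice:
  assumes u: "qRe u = 0" "norm u = 1"
    and Q: "\<And>x. Quat x a b d = slice u (Complex x r)"
    and z: "Complex x r \<noteq> 0"
  shows "szego_s c n (Quat x a b d) = c *\<^sub>R slice u (szego_slice r (2 * (n - 1)) (of_real x))"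
proof -
  let ?S = "{x. Complex x r \<noteq> 0}"
  \<comment> \<open>The line avoids the singularity at the origin unless \<open>r = 0\<close>, and
    then meets it only at \<open>x = 0\<close>.\<close>
  have "?S = (if r = 0 then - {0} else UNIV)"
    by (auto simp: complex_eq_iff)
  then have "open ?S" by (simp add: open_Compl)
  moreover have "qcnj (Quat x a b d) /\<^sub>R norm (Quat x a b d) ^ 4
      = slice u (szego_slice r 0 (of_real x))" if "x \<in> ?S" for x
  proof -
    have "slice u (szego_slice r 0 (of_real x)) = slice u (cnj (Complex x r) /\<^sub>R norm (Complex x r) ^ 4)"
      using that by (simp add: szego_slice_0 scaleR_conv_of_real divide_inverse mult.commute)
    also have "\<dots> = slice u (cnj (Complex x r)) /\<^sub>R norm (Complex x r) ^ 4"
      by (rule linear_cmul[OF bounded_linear.linear[OF bounded_linear_slice]])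
    finally show ?thesis
      by (simp only: Q qcnj_slice[OF u(1)] norm_slice[OF u])
  qed
  ultimately have "(partial_x1 ^^ (2 * (n - 1))) (\<lambda>\<tau>. qcnj \<tau> /\<^sub>R norm \<tau> ^ 4) (Quat x a b d)
      = slice u (szego_slice r (2 * (n - 1)) (of_real x))"
    by (rule funpow_partial_x1) (use z in \<open>simp_all add: has_vector_derivative_slice_szego\<close>)
  then show ?thesis by (simp add: szego_s_def)
qed

text \<open>With the second point at the origin, the conjugate term and the sum in
  \<open>szego_S\<close> vanish.\<close>

lemma heis_Kt_0:
  "heis_Kt c n t g 0 =
    szego_s c n (Quat (t + (norm (snd g))\<^sup>2) (fst g $ 1) (fst g $ 2) (fst g $ 3))"
proof -
  have "qcnj 0 = 0" by (simp add: quat_eq_iff qcnj_def)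
  moreover have "quat_of_vec4 0 = 0" "quat_of_vec3 0 = 0"
    by (simp_all add: quat_eq_iff quat_of_vec4_def quat_of_vec3_def)
  moreover have "of_real a + quat_of_vec3 v = Quat a (v $ 1) (v $ 2) (v $ 3)" for a v
    by (simp add: quat_eq_iff quat_of_vec3_def)
  ultimately show ?thesis
    by (simp add: heis_Kt_def szego_S_def siegel_point_def del: of_real_add of_real_power)
qed

theorem theorem1p2:
  fixes n :: nat and c :: real and g :: "('m::finite) heis"
  assumes "n \<ge> 2" and "CARD('m) = n - 1" and "c \<noteq> 0" and "g \<noteq> 0"
  shows "heis_K c n g \<noteq> 0"
proof -
  let ?x = "(norm (snd g))\<^sup>2" and ?m = "2 * (n - 1)"
  obtain u r where u: "qRe u = 0" "norm u = 1"
    and Q: "\<And>x. Quat x (fst g $ 1) (fst g $ 2) (fst g $ 3) = slice u (Complex x r)"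
    using Quat_eq_slice[of "fst g $ 1" "fst g $ 2" "fst g $ 3"] by metis
  \<comment> \<open>The kernel as a function of the real part alone: letting \<open>t\<close> tend
    to \<open>0\<close> becomes continuity of \<open>h\<close> at \<open>?x\<close>.\<close>
  define h where "h = (\<lambda>x. c *\<^sub>R slice u (szego_slice r ?m (of_real x)))"
  \<comment> \<open>Vanishing would kill the imaginary part, hence \<open>fst g\<close>, and
    \<open>?x\<close>, hence \<open>snd g\<close>.\<close>
  have nz: "Complex ?x r \<noteq> 0"
  proof
    assume "Complex ?x r = 0"
    then have "Quat ?x (fst g $ 1) (fst g $ 2) (fst g $ 3) = 0"
      by (simp add: Q slice_def)
    then have "g = 0"
      by (simp add: quat_eq_iff prod_eq_iff vec_eq_iff[of "fst g"] forall_3)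
    with \<open>g \<noteq> 0\<close> show False ..
  qed
  have "heis_Kt c n t g 0 = h (t + ?x)" if "t > 0" for t
  proof -
    \<comment> \<open>A positive real part keeps the approximating points away from the
      singularity.\<close>
    have "t + ?x > 0" using that by (simp add: add_pos_nonneg)
    then have "Complex (t + ?x) r \<noteq> 0" by (simp add: complex_eq_iff)
    then show ?thesis
      unfolding heis_Kt_0 h_def by (rule szego_s_slice[OF u Q])
  qed
  then have ev: "\<forall>\<^sub>F t in at_right 0. h (t + ?x) = heis_Kt c n t g 0"
    by (simp add: eventually_mono[OF eventually_at_right_less])
  have "isCont h ?x"
    unfolding h_def using has_vector_derivative_slice_szego[OF nz]
    by (intro continuous_scaleR continuous_const has_vector_derivative_continuous)
  moreover have "((\<lambda>t. t + ?x) \<longlongrightarrow> ?x) (at_right 0)"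
    by (auto intro!: tendsto_eq_intros)
  ultimately have "((\<lambda>t. h (t + ?x)) \<longlongrightarrow> h ?x) (at_right 0)"
    by (rule isCont_tendsto_compose)
  then have "((\<lambda>t. heis_Kt c n t g 0) \<longlongrightarrow> h ?x) (at_right 0)"
    using ev by (rule Lim_transform_eventually)
  \<comment> \<open>The filter \<open>at_right 0\<close> is nontrivial, so \<open>Lim\<close> is the
    limit just found.\<close>
  then have "heis_K c n g = h ?x"
    unfolding heis_K_def heis_K2_def by (intro tendsto_Lim) simp_all
  moreover have "norm (h ?x) = \<bar>c\<bar> * norm (szego_slice r ?m (of_real ?x))"
    by (simp add: h_def norm_slice[OF u])
  moreover have "szego_slice r ?m (of_real ?x) \<noteq> 0"
    using nz by (rule szego_slice_nonzero)
  ultimately show ?thesis using \<open>c \<noteq> 0\<close> by auto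
qed

end
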